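(* Let $\alpha,\gamma,\kappa,\delta,\bar S>0$. Suppose $0<\beta<1$ and the interior usage rule $\tilde u(S)=u_0+u_1S$ satisfies $u_1<0$, $\tilde u(0)>1$, and $\tilde u(\bar S)<0$. Consider the feasible usage rule that assigns $u=1$ when $\tilde u(S)\ge1$, assigns $u=0$ when $\tilde u(S)\le0$, and $u=\tilde u(S)$ otherwise. Under this rule there exists an unstable threshold $S_{\mathrm{eq}}\in(0,\bar S)$: workers with initial skill $S_0<S_{\mathrm{eq}}$ converge to $\hat S=0$, while workers with $S_0>S_{\mathrm{eq}}$ converge to $\hat S=\bar S$.
   Context: Worker skill $S_t\in[0,\bar S]$ evolves under usage $u\in[0,1]$ by $\dot S=\kappa\bar S(1-u)-\kappa S$. Here $\bar S$ is the worker's maximum skill. The interior usage rule is the unconstrained optimal policy of the problem of maximizing $\int_0^\infty e^{-\delta t}p(S_t,u_t)\,dt$ with $p(S,u)=(1-u)S+[\alpha+\beta S-\gamma u]u$: its coefficients are $$u_0=\frac{\alpha-\kappa b\bar S}{2\gamma},\qquad u_1=\frac{\beta-1-2\kappa a\bar S}{2\gamma},$$ where $V(S)=aS^2+bS+c$ is the quadratic solution of the Bellman equation $\delta V(S)=\max_u\{p(S,u)+V'(S)[\kappa\bar S(1-u)-\kappa S]\}$ (stable root): with $D=[\kappa((\beta-1)\bar S+2\gamma)+\gamma\delta]^2-\kappa^2(\beta-1)^2\bar S^2>0$, $$a=\frac{\kappa((\beta-1)\bar S+2\gamma)+\gamma\delta-\sqrt D}{2\kappa^2\bar S^2},\qquad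 b=\frac{2\gamma(1+2a\kappa\bar S)+\alpha(\beta-1-2\kappa a\bar S)}{2(\delta+\kappa)\gamma+\kappa(\beta-1)\bar S-2\kappa^2a\bar S^2}.$$ An unstable threshold is an equilibrium ($\dot S=0$) from which nearby trajectories move away. *)

theory Defs
  imports Complex_Main
begin

definition skill_drift :: "real \<Rightarrow> real \<Rightarrow> real \<Rightarrow> real \<Rightarrow> real" where
  "skill_drift \<kappa> Smax S u = \<kappa> * Smax * (1 - u) - \<kappa> * S"

definition productivity :: "real \<Rightarrow> real \<Rightarrow> real \<Rightarrow> real \<Rightarrow> real \<Rightarrow> real" where
  "productivity \<alpha> \<beta> \<gamma> S u = (1 - u) * S + (\<alpha> + \<beta> * S - \<gamma> * u) * u"

definition discr :: "real \<Rightarrow> real \<Rightarrow> real \<Rightarrow> real \<Rightarrow> real \<Rightarrow> real" where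
  "discr \<beta> \<gamma> \<kappa> \<delta> Smax =
     (\<kappa> * ((\<beta> - 1) * Smax + 2 * \<gamma>) + \<gamma> * \<delta>)^2 - \<kappa>^2 * (\<beta> - 1)^2 * Smax^2"

text \<open>Coefficients of the quadratic value function \<open>V S = a * S^2 + b * S + c\<close>; of the
  two roots of the quadratic equation for \<open>a\<close> the smaller one is the stable one.
  Lemma \<open>bellman_interior_usage\<close> below checks them against the Bellman equation.\<close>

definition value_a :: "real \<Rightarrow> real \<Rightarrow> real \<Rightarrow> real \<Rightarrow> real \<Rightarrow> real" where
  "value_a \<beta> \<gamma> \<kappa> \<delta> Smax =
     (\<kappa> * ((\<beta> - 1) * Smax + 2 * \<gamma>) + \<gamma> * \<delta> - sqrt (discr \<beta> \<gamma> \<kappa> \<delta> Smax))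
       / (2 * \<kappa>^2 * Smax^2)"

definition value_b :: "real \<Rightarrow> real \<Rightarrow> real \<Rightarrow> real \<Rightarrow> real \<Rightarrow> real \<Rightarrow> real" where
  "value_b \<alpha> \<beta> \<gamma> \<kappa> \<delta> Smax =
     (let a = value_a \<beta> \<gamma> \<kappa> \<delta> Smax in
       (2 * \<gamma> * (1 + 2 * a * \<kappa> * Smax) + \<alpha> * (\<beta> - 1 - 2 * \<kappa> * a * Smax))
         / (2 * (\<delta> + \<kappa>) * \<gamma> + \<kappa> * (\<beta> - 1) * Smax - 2 * \<kappa>^2 * a * Smax^2))"

definition usage_u0 :: "real \<Rightarrow> real \<Rightarrow> real \<Rightarrow> real \<Rightarrow> real \<Rightarrow> real \<Rightarrow> real" where
  "usage_u0 \<alpha> \<beta> \<gamma> \<kappa> \<delta> Smax =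
     (\<alpha> - \<kappa> * value_b \<alpha> \<beta> \<gamma> \<kappa> \<delta> Smax * Smax) / (2 * \<gamma>)"

definition usage_u1 :: "real \<Rightarrow> real \<Rightarrow> real \<Rightarrow> real \<Rightarrow> real \<Rightarrow> real" where
  "usage_u1 \<beta> \<gamma> \<kappa> \<delta> Smax =
     (\<beta> - 1 - 2 * \<kappa> * value_a \<beta> \<gamma> \<kappa> \<delta> Smax * Smax) / (2 * \<gamma>)"

definition interior_usage ::
  "real \<Rightarrow> real \<Rightarrow> real \<Rightarrow> real \<Rightarrow> real \<Rightarrow> real \<Rightarrow> real \<Rightarrow> real" where
  "interior_usage \<alpha> \<beta> \<gamma> \<kappa> \<delta> Smax S =
     usage_u0 \<alpha> \<beta> \<gamma> \<kappa> \<delta> Smax + usage_u1 \<beta> \<gamma> \<kappa> \<delta> Smax * S"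

definition feasible_usage :: "(real \<Rightarrow> real) \<Rightarrow> real \<Rightarrow> real" where
  "feasible_usage v S = (if v S \<ge> 1 then 1 else if v S \<le> 0 then 0 else v S)"

text \<open>Skill paths on the time axis \<open>{0..}\<close> under a feedback usage rule \<open>u\<close>
  (one-sided derivative at time 0); the state space is \<open>{0..Smax}\<close>.\<close>

definition skill_trajectory ::
  "real \<Rightarrow> real \<Rightarrow> (real \<Rightarrow> real) \<Rightarrow> (real \<Rightarrow> real) \<Rightarrow> bool" where
  "skill_trajectory \<kappa> Smax u S \<longleftrightarrow>
     (\<forall>t\<ge>0. S t \<in> {0..Smax} \<and>
        (S has_real_derivative skill_drift \<kappa> Smax (S t) (u (S t))) (at t within {0..}))"

text \<open>Existence of a path is part of the definition, so that convergence is not vacuous.\<close>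

definition worker_converges ::
  "real \<Rightarrow> real \<Rightarrow> (real \<Rightarrow> real) \<Rightarrow> real \<Rightarrow> real \<Rightarrow> bool" where
  "worker_converges \<kappa> Smax u S0 L \<longleftrightarrow>
     (\<exists>S. skill_trajectory \<kappa> Smax u S \<and> S 0 = S0) \<and>
     (\<forall>S. skill_trajectory \<kappa> Smax u S \<and> S 0 = S0 \<longrightarrow> (S \<longlongrightarrow> L) at_top)"

text \<open>``Nearby trajectories move away'': for some radius \<open>e\<close>, a path starting within
  distance \<open>e\<close> of the equilibrium, but not at it, gets strictly farther away for as long
  as it has stayed within distance \<open>e\<close>, and it does not stay there forever.\<close>

definition unstable_threshold ::
  "real \<Rightarrow> real \<Rightarrow> (real \<Rightarrow> real) \<Rightarrow> real \<Rightarrow> bool" where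
  "unstable_threshold \<kappa> Smax u s \<longleftrightarrow>
     skill_drift \<kappa> Smax s (u s) = 0 \<and>
     (\<exists>e>0. \<forall>S. skill_trajectory \<kappa> Smax u S \<and> S 0 \<noteq> s \<and> \<bar>S 0 - s\<bar> < e \<longrightarrow>
        (\<forall>t1 t2. 0 \<le> t1 \<and> t1 < t2 \<and> (\<forall>t\<in>{0..t2}. \<bar>S t - s\<bar> < e) \<longrightarrow>
            \<bar>S t1 - s\<bar> < \<bar>S t2 - s\<bar>) \<and>
        (\<exists>t\<ge>0. \<bar>S t - s\<bar> \<ge> e))"

lemma bellman_interior_usage:
  fixes \<alpha> \<beta> \<gamma> \<kappa> \<delta> Smax :: real
  assumes pos: "\<gamma> > 0" "\<kappa> > 0" "\<delta> > 0" "Smax > 0"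
    and D: "discr \<beta> \<gamma> \<kappa> \<delta> Smax > 0"
  defines "a \<equiv> value_a \<beta> \<gamma> \<kappa> \<delta> Smax" and "b \<equiv> value_b \<alpha> \<beta> \<gamma> \<kappa> \<delta> Smax"
    and "v \<equiv> interior_usage \<alpha> \<beta> \<gamma> \<kappa> \<delta> Smax"
  defines "H \<equiv> \<lambda>S u. productivity \<alpha> \<beta> \<gamma> S u + (2 * a * S + b) * skill_drift \<kappa> Smax S u"
  shows "(\<forall>S u. H S u \<le> H S (v S)) \<and>
    (\<exists>c. \<forall>S. \<delta> * (a * S^2 + b * S + c) = H S (v S))"
proof -
  define u0 where "u0 = usage_u0 \<alpha> \<beta> \<gamma> \<kappa> \<delta> Smax"
  define u1 where "u1 = usage_u1 \<beta> \<gamma> \<kappa> \<delta> Smax"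
  define r where "r = sqrt (discr \<beta> \<gamma> \<kappa> \<delta> Smax)"
  define A where "A = \<kappa> * ((\<beta> - 1) * Smax + 2 * \<gamma>) + \<gamma> * \<delta>"
  have v: "v S = u0 + u1 * S" for S
    by (simp add: v_def interior_usage_def u0_def u1_def)
  have u0: "2 * \<gamma> * u0 = \<alpha> - \<kappa> * b * Smax"
    using pos by (simp add: u0_def usage_u0_def b_def)
  have u1: "2 * \<gamma> * u1 = \<beta> - 1 - 2 * \<kappa> * a * Smax"
    using pos by (simp add: u1_def usage_u1_def a_def)
  have r: "r > 0" "r^2 = A^2 - \<kappa>^2 * (\<beta> - 1)^2 * Smax^2"
    using D by (simp_all add: r_def A_def discr_def)
  have a: "2 * \<kappa>^2 * Smax^2 * a = A - r"
    using pos by (simp add: a_def value_a_def r_def A_def)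
  have "(2 * \<kappa>^2 * Smax^2 * a - A)^2 = A^2 - \<kappa>^2 * (\<beta> - 1)^2 * Smax^2"
    using a r(2) by simp
  then have "4 * \<kappa>^2 * Smax^2 * (\<kappa>^2 * Smax^2 * a^2 - A * a + (\<beta> - 1)^2 / 4) = 0"
    by (simp add: power2_eq_square field_simps)
  then have qa: "\<kappa>^2 * Smax^2 * a^2 - A * a + (\<beta> - 1)^2 / 4 = 0"
    using pos by simp
  have den: "2 * (\<delta> + \<kappa>) * \<gamma> + \<kappa> * (\<beta> - 1) * Smax - 2 * \<kappa>^2 * a * Smax^2 = \<gamma> * \<delta> + r"
    using a by (simp add: A_def algebra_simps)
  have qb: "b * (2 * (\<delta> + \<kappa>) * \<gamma> + \<kappa> * (\<beta> - 1) * Smax - 2 * \<kappa>^2 * a * Smax^2)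
      = 2 * \<gamma> * (1 + 2 * a * \<kappa> * Smax) + \<alpha> * (\<beta> - 1 - 2 * \<kappa> * a * Smax)"
  proof -
    have "\<gamma> * \<delta> + r \<noteq> 0"
      using pos r(1) by (smt (verit) mult_pos_pos)
    then show ?thesis
      using den by (simp add: b_def value_b_def Let_def a_def)
  qed
  have sq: "H S u = S + (2 * a * S + b) * \<kappa> * (Smax - S) + \<gamma> * (v S)^2 - \<gamma> * (u - v S)^2" for S u
  proof -
    have "2 * \<gamma> * v S = \<alpha> - \<kappa> * b * Smax + (\<beta> - 1 - 2 * \<kappa> * a * Smax) * S"
      using u0 u1 unfolding v by (metis (no_types, opaque_lifting) distrib_left mult.assoc)
    then have "2 * \<gamma> * v S * u = (\<alpha> - \<kappa> * b * Smax + (\<beta> - 1 - 2 * \<kappa> * a * Smax) * S) * u"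
      by simp
    then show ?thesis
      by (simp add: H_def productivity_def skill_drift_def power2_eq_square algebra_simps)
  qed
  have ca: "\<delta> * a = - 2 * a * \<kappa> + \<gamma> * u1^2"
  proof -
    have "4 * \<gamma> * (\<gamma> * u1^2) = (\<beta> - 1 - 2 * \<kappa> * a * Smax)^2"
      using u1 by (simp flip: u1 add: power2_eq_square)
    then have "4 * \<gamma> * (\<delta> * a) = 4 * \<gamma> * (- 2 * a * \<kappa> + \<gamma> * u1^2)"
      using qa by (simp add: A_def power2_eq_square field_simps)
    then show ?thesis using pos by simp
  qed
  have cb: "\<delta> * b = 1 + 2 * a * \<kappa> * Smax - \<kappa> * b + 2 * \<gamma> * u0 * u1"
  proof -
    have "2 * \<gamma> * (2 * \<gamma> * u0 * u1) = (\<alpha> - \<kappa> * b * Smax) * (\<beta> - 1 - 2 * \<kappa> * a * Smax)"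
      by (simp flip: u0 u1)
    then have "2 * \<gamma> * (\<delta> * b) = 2 * \<gamma> * (1 + 2 * a * \<kappa> * Smax - \<kappa> * b + 2 * \<gamma> * u0 * u1)"
      using qb by (simp add: power2_eq_square algebra_simps)
    then show ?thesis using pos by simp
  qed
  have "\<delta> * (a * S^2 + b * S + (b * \<kappa> * Smax + \<gamma> * u0^2) / \<delta>) = H S (v S)" for S
  proof -
    have "\<delta> * (a * S^2 + b * S + (b * \<kappa> * Smax + \<gamma> * u0^2) / \<delta>)
        = (\<delta> * a) * S^2 + (\<delta> * b) * S + b * \<kappa> * Smax + \<gamma> * u0^2"
      using pos by (simp add: field_simps)
    also have "\<dots> = H S (v S)"
      unfolding sq ca cb v by (simp add: power2_eq_square algebra_simps)
    finally show ?thesis .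
  qed
  moreover have "H S u \<le> H S (v S)" for S u
    unfolding sq using pos by simp
  ultimately show ?thesis by blast
qed

end

theory Submission
  imports Defs
begin

text \<open>The drift of the feasible rule is piecewise affine: it is \<open>- \<kappa> S\<close> near \<open>0\<close>,
  \<open>\<kappa> (Smax - S)\<close> near \<open>Smax\<close>, and \<open>m (S - s)\<close> with \<open>m > 0\<close> in between. Hence the drift always
  points away from \<open>s\<close>, so \<open>\<bar>S t - s\<bar>\<close> never decreases along a path; a path that starts below
  \<open>s\<close> stays below its initial value, where the drift is at most \<open>- \<eta> S\<close>, and decays
  exponentially. The reflection \<open>S \<mapsto> Smax - S\<close>, \<open>u \<mapsto> 1 - u\<close> preserves the class of rules, so
  the case above \<open>s\<close> follows from the case below.\<close>

section \<open>Monotonicity on the time half-line\<close>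

text \<open>Path derivatives are taken within \<open>{0..}\<close>, one-sided at 0. The mean value
  theorem evaluates them only at interior times, where they are two-sided.\<close>

lemma nondecreasing_from_0:
  fixes g g' :: "real \<Rightarrow> real"
  assumes "0 \<le> T"
    and der: "\<And>t. 0 \<le> t \<Longrightarrow> (g has_real_derivative g' t) (at t within {0..})"
    and nonneg: "\<And>t. 0 < t \<Longrightarrow> t < T \<Longrightarrow> 0 \<le> g' t"
  shows "g 0 \<le> g T"
proof (cases "T = 0")
  case False
  have "continuous_on {0..T} g"
    by (rule continuous_on_subset[of "{0..}"], rule DERIV_continuous_on[of _ _ g'])
      (use der in auto)
  moreover have D: "(g has_real_derivative g' t) (at t)" if "0 < t" for t
    using der[of t] that at_within_open_subset[of t "{0<..}" "{0..}"] by force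
  ultimately obtain l z where z: "0 < z" "z < T" "(g has_real_derivative l) (at z)"
    "g T - g 0 = (T - 0) * l"
    using MVT[of 0 T g] False assms(1) by (force simp: real_differentiable_def)
  then have "l = g' z"
    using D DERIV_unique by blast
  then show ?thesis
    using z nonneg[of z] by (metis diff_ge_0_iff_ge diff_zero assms(1) mult_nonneg_nonneg)
qed simp

lemma divide_less_divide_iff:
  fixes a b c d :: real
  assumes "0 < b" "0 < d"
  shows "a / b < c / d \<longleftrightarrow> a * d < c * b"
  using assms by (simp add: pos_divide_less_eq pos_less_divide_eq)

section \<open>The piecewise affine drift\<close>

text \<open>The coefficients stay abstract so that the reflected rule is another instance.\<close>

locale clipped_usage =
  fixes \<kappa> M u0 u1 :: real
  assumes \<kappa>: "0 < \<kappa>" and M: "0 < M" and u1: "u1 < 0" and u0: "1 < u0" and uM: "u0 + u1 * M < 0"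
begin

definition rule :: "real \<Rightarrow> real" where
  "rule = feasible_usage (\<lambda>S. u0 + u1 * S)"

text \<open>At \<open>lo\<close> and \<open>hi\<close> the affine usage equals 1 and 0, so it is
  unclipped in between. \<open>rate\<close> and \<open>thr\<close> are the slope and the zero of the
  drift there.\<close>

definition lo :: real where "lo = (u0 - 1) / (- u1)"
definition hi :: real where "hi = u0 / (- u1)"
definition rate :: real where "rate = \<kappa> * (- M * u1 - 1)"
definition thr :: real where "thr = M * (u0 - 1) / (- M * u1 - 1)"

text \<open>The affine usage falls from above 1 to below 0 across an interval of length
  \<open>M\<close>. This steepness makes the middle equilibrium repelling.\<close>

lemma slope_gt_1: "1 < - M * u1"
  using u0 uM by (simp add: algebra_simps)

lemma rate_pos: "0 < rate"
  using slope_gt_1 \<kappa> by (simp add: rate_def)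

text \<open>With denominators cleared, the first two inequalities come down to
  \<open>1 < u0\<close>, the last two to \<open>u0 + u1 * M < 0\<close>.\<close>

lemma order: "0 < lo" "lo < thr" "thr < hi" "hi < M"
proof -
  show "0 < lo" unfolding lo_def using u0 u1 by (intro divide_pos_pos) auto
  have "(u0 - 1) * (- M * u1 - 1) < M * (u0 - 1) * (- u1)"
    using u0 by (simp add: algebra_simps)
  then show "lo < thr"
    unfolding lo_def thr_def using u1 slope_gt_1 by (subst divide_less_divide_iff) simp_all
  have "M * (u0 - 1) * (- u1) < u0 * (- M * u1 - 1)"
    using uM by (simp add: algebra_simps)
  then show "thr < hi"
    unfolding hi_def thr_def using u1 slope_gt_1 by (subst divide_less_divide_iff) simp_all
  show "hi < M" using u1 uM by (simp add: hi_def field_simps)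
qed

lemma drift_lo: "S \<le> lo \<Longrightarrow> skill_drift \<kappa> M S (rule S) = - \<kappa> * S"
  using u1 by (simp add: rule_def feasible_usage_def skill_drift_def lo_def field_simps)

lemma drift_hi: "hi \<le> S \<Longrightarrow> skill_drift \<kappa> M S (rule S) = \<kappa> * (M - S)"
  using u1 by (simp add: rule_def feasible_usage_def skill_drift_def hi_def field_simps)

lemma drift_mid:
  assumes "lo \<le> S" "S \<le> hi"
  shows "skill_drift \<kappa> M S (rule S) = rate * (S - thr)"
proof -
  have "rule S = u0 + u1 * S"
    using assms u1 by (auto simp: rule_def feasible_usage_def lo_def hi_def field_simps)
  then have "skill_drift \<kappa> M S (rule S) = rate * S - \<kappa> * M * (u0 - 1)"
    by (simp add: skill_drift_def rate_def algebra_simps)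
  also have "\<kappa> * M * (u0 - 1) = rate * thr"
    using slope_gt_1 by (simp add: rate_def thr_def)
  finally show ?thesis
    by (simp add: right_diff_distrib)
qed

text \<open>The product is half the derivative of the squared distance to \<open>thr\<close> along a
  path.\<close>

lemma drift_outward:
  assumes "0 \<le> S" "S \<le> M"
  shows "0 \<le> skill_drift \<kappa> M S (rule S) * (S - thr)"
proof -
  consider "S \<le> lo" | "lo \<le> S" "S \<le> hi" | "hi \<le> S" by linarith
  then show ?thesis
  proof cases
    case 1
    then show ?thesis
      using drift_lo order \<kappa> assms by (simp add: mult_nonneg_nonpos)
  next
    case 2
    have "0 \<le> rate * ((S - thr) * (S - thr))"
      using rate_pos by simp
    then show ?thesis
      using drift_mid[OF 2] by (simp only: mult.assoc)
  next
    case 3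
    then show ?thesis
      using drift_hi order \<kappa> assms by simp
  qed
qed

text \<open>On the middle piece the drift is at most the negative constant
  \<open>- rate * (thr - S0)\<close>; since \<open>S \<le> M\<close>, dividing by \<open>M\<close>
  turns this into a multiple of \<open>S\<close>. The minimum with \<kappa> covers the low
  piece.\<close>

lemma drift_le_linear:
  assumes "0 \<le> S" "S \<le> S0" "S0 < thr"
  shows "skill_drift \<kappa> M S (rule S) \<le> - min \<kappa> (rate * (thr - S0) / M) * S"
proof (cases "S \<le> lo")
  case True
  have "min \<kappa> (rate * (thr - S0) / M) * S \<le> \<kappa> * S"
    using assms by (intro mult_right_mono) auto
  then show ?thesis using drift_lo[OF True] by simp
next
  case False
  have "min \<kappa> (rate * (thr - S0) / M) * S \<le> rate * (thr - S0) / M * S"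
    using assms by (intro mult_right_mono) auto
  also have "\<dots> \<le> rate * (thr - S0) / M * M"
    using assms order M rate_pos by (intro mult_left_mono) auto
  also have "\<dots> \<le> rate * (thr - S)"
    using assms M rate_pos by simp
  finally show ?thesis
    using drift_mid[of S] False assms order by (simp add: algebra_simps)
qed

section \<open>Convergence to 0 from below, and existence of such paths\<close>

text \<open>The squared distance to \<open>thr\<close> never drops, so by continuity the path cannot
  cross \<open>thr\<close>, where it would vanish. On the same side, being no closer means lying no
  higher.\<close>

lemma trajectory_below:
  assumes S: "skill_trajectory \<kappa> M rule S" and lt: "S 0 < thr" and T: "0 \<le> T"
  shows "S T \<le> S 0"
proof -
  have far: "(S 0 - thr)\<^sup>2 \<le> (S t - thr)\<^sup>2" if "0 \<le> t" for t
  proof (rule nondecreasing_from_0[OF that,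
        where g' = "\<lambda>t. 2 * (skill_drift \<kappa> M (S t) (rule (S t)) * (S t - thr))"])
    fix r :: real assume "0 \<le> r"
    then have "(S has_real_derivative skill_drift \<kappa> M (S r) (rule (S r))) (at r within {0..})"
      using S by (simp add: skill_trajectory_def)
    then show "((\<lambda>t. (S t - thr)\<^sup>2) has_real_derivative
        2 * (skill_drift \<kappa> M (S r) (rule (S r)) * (S r - thr))) (at r within {0..})"
      by (auto intro!: derivative_eq_intros)
  next
    fix r :: real assume "0 < r"
    then show "0 \<le> 2 * (skill_drift \<kappa> M (S r) (rule (S r)) * (S r - thr))"
      using S drift_outward[of "S r"] by (simp add: skill_trajectory_def)
  qed
  have cont: "continuous_on {0..T} S"
    by (rule continuous_on_subset[of "{0..}"],
        rule DERIV_continuous_on[of _ _ "\<lambda>t. skill_drift \<kappa> M (S t) (rule (S t))"])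
      (use S in \<open>auto simp: skill_trajectory_def\<close>)
  have "S T < thr"
  proof (rule ccontr)
    assume "\<not> S T < thr"
    then obtain t where "0 \<le> t" "S t = thr"
      using IVT'[of S 0 thr T] cont lt T by auto
    then show False using far[of t] lt by simp
  qed
  then show ?thesis
    using far[OF T] lt by (simp add: abs_le_square_iff[symmetric])
qed

lemma trajectory_tendsto_0:
  assumes S: "skill_trajectory \<kappa> M rule S" and lt: "S 0 < thr"
  shows "(S \<longlongrightarrow> 0) at_top"
proof -
  define \<eta> where "\<eta> = min \<kappa> (rate * (thr - S 0) / M)"
  have \<eta>: "0 < \<eta>"
    using \<kappa> rate_pos lt M by (simp add: \<eta>_def)
  have bound: "S T \<le> S 0 * exp (- \<eta> * T)" if T: "0 \<le> T" for T
  proof -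
    \<comment> \<open>Integrating factor: \<open>S t * exp (\<eta> * t)\<close> is nonincreasing;
      the sign is flipped to fit \<open>nondecreasing_from_0\<close>.\<close>
    have "- (S 0 * exp (\<eta> * 0)) \<le> - (S T * exp (\<eta> * T))"
    proof (rule nondecreasing_from_0[OF T, where g = "\<lambda>t. - (S t * exp (\<eta> * t))"
          and g' = "\<lambda>t. - exp (\<eta> * t) * (skill_drift \<kappa> M (S t) (rule (S t)) + \<eta> * S t)"])
      fix r :: real assume "0 \<le> r"
      then have "(S has_real_derivative skill_drift \<kappa> M (S r) (rule (S r))) (at r within {0..})"
        using S by (simp add: skill_trajectory_def)
      then show "((\<lambda>t. - (S t * exp (\<eta> * t))) has_real_derivative
          - exp (\<eta> * r) * (skill_drift \<kappa> M (S r) (rule (S r)) + \<eta> * S r)) (at r within {0..})"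
        by (auto intro!: derivative_eq_intros simp: algebra_simps)
    next
      fix r :: real assume r: "0 < r"
      then have "skill_drift \<kappa> M (S r) (rule (S r)) + \<eta> * S r \<le> 0"
        using S drift_le_linear[of "S r" "S 0"] trajectory_below[OF S lt, of r] lt
        by (simp add: skill_trajectory_def \<eta>_def)
      then show "0 \<le> - exp (\<eta> * r) * (skill_drift \<kappa> M (S r) (rule (S r)) + \<eta> * S r)"
        by (intro mult_nonpos_nonpos) auto
    qed
    then show ?thesis
      by (simp add: exp_minus field_simps)
  qed
  have "((\<lambda>t. S 0 * exp (- \<eta> * t)) \<longlongrightarrow> S 0 * 0) at_top"
    using \<eta> by (intro tendsto_mult tendsto_const filterlim_compose[OF exp_at_bot]
        filterlim_tendsto_neg_mult_at_bot[OF tendsto_const] filterlim_ident) auto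
  then have upper: "((\<lambda>t. S 0 * exp (- \<eta> * t)) \<longlongrightarrow> 0) at_top"
    by simp
  show ?thesis
  proof (rule tendsto_sandwich[OF _ _ tendsto_const upper])
    show "\<forall>\<^sub>F t in at_top. 0 \<le> S t"
      using eventually_ge_at_top[of 0]
      by eventually_elim (use S in \<open>simp add: skill_trajectory_def\<close>)
    show "\<forall>\<^sub>F t in at_top. S t \<le> S 0 * exp (- \<eta> * t)"
      using eventually_ge_at_top[of 0] by eventually_elim (rule bound)
  qed
qed

text \<open>The affine pieces are glued only once, at time 0; every initial value in \<open>{0<..<thr}\<close> is
  then reached by a time shift of this one path.\<close>

definition orbit :: "real \<Rightarrow> real" where
  "orbit t = (if t \<le> 0 then thr - (thr - lo) * exp (rate * t) else lo * exp (- \<kappa> * t))"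

lemma departure_bounds:
  assumes "t \<le> 0"
  shows "0 \<le> (thr - lo) * exp (rate * t)" "(thr - lo) * exp (rate * t) \<le> thr - lo"
proof -
  show "0 \<le> (thr - lo) * exp (rate * t)"
    using order by simp
  have "exp (rate * t) \<le> 1"
    using assms rate_pos by (simp add: mult_nonneg_nonpos)
  then show "(thr - lo) * exp (rate * t) \<le> thr - lo"
    using order by (intro mult_left_le) auto
qed

lemma orbit_bounds: "0 \<le> orbit t" "orbit t \<le> M"
proof -
  have "0 \<le> orbit t \<and> orbit t \<le> M"
  proof (cases "t \<le> 0")
    case True
    then have "orbit t = thr - (thr - lo) * exp (rate * t)"
      by (simp add: orbit_def)
    then show ?thesis
      using order departure_bounds[OF True] by linarith
  next
    case False
    then have "lo * exp (- \<kappa> * t) \<le> lo * 1"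
      using \<kappa> order by (intro mult_left_mono) auto
    moreover have "orbit t = lo * exp (- \<kappa> * t)"
      using False by (simp add: orbit_def)
    moreover have "0 \<le> lo * exp (- \<kappa> * t)"
      using order by simp
    ultimately show ?thesis
      using order by linarith
  qed
  then show "0 \<le> orbit t" "orbit t \<le> M" by auto
qed

lemma orbit_derivative: "(orbit has_real_derivative skill_drift \<kappa> M (orbit t) (rule (orbit t))) (at t)"
proof -
  let ?p = "\<lambda>t. thr - (thr - lo) * exp (rate * t)" and ?q = "\<lambda>t. lo * exp (- \<kappa> * t)"
  \<comment> \<open>An arbitrary \<open>X\<close> lets one fact serve both the two-sided derivative
    and the one-sided derivative at the gluing time.\<close>
  have p: "(?p has_real_derivative skill_drift \<kappa> M (?p t) (rule (?p t))) (at t within X)"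
    if "t \<le> 0" for t X
  proof -
    have "skill_drift \<kappa> M (?p t) (rule (?p t)) = rate * (?p t - thr)"
      using order departure_bounds[OF that] by (intro drift_mid) linarith+
    then show ?thesis
      by (auto intro!: derivative_eq_intros simp: algebra_simps)
  qed
  have q: "(?q has_real_derivative skill_drift \<kappa> M (?q t) (rule (?q t))) (at t within X)"
    if "0 \<le> t" for t X
  proof -
    have "lo * exp (- \<kappa> * t) \<le> lo * 1"
      using that \<kappa> order by (intro mult_left_mono) auto
    then have "skill_drift \<kappa> M (?q t) (rule (?q t)) = - \<kappa> * ?q t"
      by (intro drift_lo) auto
    then show ?thesis
      by (auto intro!: derivative_eq_intros)
  qed
  consider "t < 0" | "0 < t" | "t = 0" by linarith
  then show ?thesis
  proof cases
    case 1
    have "orbit t = ?p t" using 1 by (simp add: orbit_def)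
    moreover have "(?p has_real_derivative skill_drift \<kappa> M (?p t) (rule (?p t))) (at t)"
      using 1 by (intro p) simp
    ultimately show ?thesis
      using 1 by (simp only:) (erule has_field_derivative_transform_within_open[of _ _ _ "{..<0}"];
        simp add: orbit_def)
  next
    case 2
    have "orbit t = ?q t" using 2 by (simp add: orbit_def)
    moreover have "(?q has_real_derivative skill_drift \<kappa> M (?q t) (rule (?q t))) (at t)"
      using 2 by (intro q) simp
    ultimately show ?thesis
      using 2 by (simp only:) (erule has_field_derivative_transform_within_open[of _ _ _ "{0<..}"];
        simp add: orbit_def)
  next
    case 3
    \<comment> \<open>Both branches take the value \<open>lo\<close> at time 0, and each one-sided
      derivative is the drift at that same point, so the two agree.\<close>
    have o: "orbit 0 = ?p 0" "orbit 0 = ?q 0" by (simp_all add: orbit_def)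
    have "(orbit has_real_derivative skill_drift \<kappa> M (orbit 0) (rule (orbit 0))) (at 0 within {..0})"
      using p[of 0 "{..0}"] unfolding o(1)
      by (rule has_field_derivative_transform_within[of _ _ _ _ 1]) (auto simp: orbit_def)
    then have "(orbit has_real_derivative skill_drift \<kappa> M (orbit 0) (rule (orbit 0))) (at_left 0)"
      by (rule DERIV_subset) auto
    moreover have "(orbit has_real_derivative skill_drift \<kappa> M (orbit 0) (rule (orbit 0))) (at 0 within {0..})"
      using q[of 0 "{0..}"] unfolding o(2)
      by (rule has_field_derivative_transform_within[of _ _ _ _ 1]) (auto simp: orbit_def)
    then have "(orbit has_real_derivative skill_drift \<kappa> M (orbit 0) (rule (orbit 0))) (at_right 0)"
      by (rule DERIV_subset) auto
    ultimately show ?thesis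
      unfolding 3 has_field_derivative_iff by (rule filterlim_split_at)
  qed
qed

text \<open>Each branch is solved for its time: the one for \<open>t \<le> 0\<close> covers the
  values from \<open>lo\<close> up to \<open>thr\<close>, the exponential decay those below
  \<open>lo\<close>.\<close>

lemma orbit_surj:
  assumes "0 < x" "x < thr"
  obtains t where "orbit t = x"
proof (cases "lo \<le> x")
  case True
  define t where "t = ln ((thr - x) / (thr - lo)) / rate"
  have "exp (rate * t) = (thr - x) / (thr - lo)" "t \<le> 0"
    using assms True rate_pos order by (auto simp: t_def divide_le_0_iff)
  then have "orbit t = x"
    using order by (simp add: orbit_def)
  then show ?thesis by (rule that)
next
  case False
  define t where "t = - ln (x / lo) / \<kappa>"
  have "exp (- \<kappa> * t) = x / lo" "0 < t"
    using assms False \<kappa> order by (auto simp: t_def divide_less_0_iff)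
  then have "orbit t = x"
    using order by (simp add: orbit_def)
  then show ?thesis by (rule that)
qed

lemma trajectory_exists:
  assumes "0 \<le> S0" "S0 < thr"
  shows "\<exists>S. skill_trajectory \<kappa> M rule S \<and> S 0 = S0"
proof (cases "S0 = 0")
  case True
  \<comment> \<open>The orbit stays positive, so initial skill 0 is served by the constant
    path.\<close>
  have "skill_trajectory \<kappa> M rule (\<lambda>_. 0)"
    using M drift_lo[of 0] order by (simp add: skill_trajectory_def)
  then show ?thesis using True by blast
next
  case False
  then obtain r where r: "orbit r = S0"
    using orbit_surj assms by (metis less_eq_real_def)
  have "((\<lambda>t. orbit (t + r)) has_real_derivative
      skill_drift \<kappa> M (orbit (t + r)) (rule (orbit (t + r)))) (at t)" for t
    using orbit_derivative[of "t + r"] by (rule DERIV_shift[THEN iffD1])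
  then have "skill_trajectory \<kappa> M rule (\<lambda>t. orbit (t + r))"
    unfolding skill_trajectory_def using orbit_bounds
    by (simp add: has_field_derivative_at_within)
  then show ?thesis
    using r by (intro exI[of _ "\<lambda>t. orbit (t + r)"]) simp
qed

lemma converges_0:
  assumes "0 \<le> S0" "S0 < thr"
  shows "worker_converges \<kappa> M rule S0 0"
  using trajectory_exists[OF assms] trajectory_tendsto_0 assms
  unfolding worker_converges_def by blast

section \<open>Escape from the threshold\<close>

text \<open>The radius keeps the path between \<open>lo\<close> and \<open>hi\<close>, where the
  displacement satisfies a linear equation. Multiplied by \<open>exp (- rate * t)\<close> it has
  zero derivative; constancy follows from monotonicity of this function and of its negative.\<close>

lemma trajectory_near_thr:
  assumes S: "skill_trajectory \<kappa> M rule S" and T: "0 \<le> T"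
    and near: "\<And>t. 0 \<le> t \<Longrightarrow> t \<le> T \<Longrightarrow> \<bar>S t - thr\<bar> < min (thr - lo) (hi - thr)"
  shows "\<bar>S T - thr\<bar> = \<bar>S 0 - thr\<bar> * exp (rate * T)"
proof -
  let ?g' = "\<lambda>t. exp (- rate * t) * (skill_drift \<kappa> M (S t) (rule (S t)) - rate * (S t - thr))"
  have der: "((\<lambda>t. (S t - thr) * exp (- rate * t)) has_real_derivative ?g' t) (at t within {0..})"
    if "0 \<le> t" for t
  proof -
    have "(S has_real_derivative skill_drift \<kappa> M (S t) (rule (S t))) (at t within {0..})"
      using S that by (simp add: skill_trajectory_def)
    then show ?thesis
      by (auto intro!: derivative_eq_intros simp: algebra_simps)
  qed
  have zero: "?g' t = 0" if "0 < t" "t < T" for t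
    using near[of t] that drift_mid[of "S t"] by auto
  have "(S 0 - thr) * exp (- rate * 0) \<le> (S T - thr) * exp (- rate * T)"
    by (rule nondecreasing_from_0[OF T der]) (simp_all only: zero order_refl)
  moreover have "- ((S 0 - thr) * exp (- rate * 0)) \<le> - ((S T - thr) * exp (- rate * T))"
    by (rule nondecreasing_from_0[OF T DERIV_minus[OF der]]) (simp_all only: zero minus_zero order_refl)
  ultimately have "S T - thr = (S 0 - thr) * exp (rate * T)"
    by (simp add: exp_minus field_simps)
  then show ?thesis by (simp add: abs_mult)
qed

lemma unstable: "unstable_threshold \<kappa> M rule thr"
proof -
  let ?e = "min (thr - lo) (hi - thr)"
  have e: "0 < ?e" using order by simp
  have away: "\<bar>S t1 - thr\<bar> < \<bar>S t2 - thr\<bar>"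
    if "skill_trajectory \<kappa> M rule S" "S 0 \<noteq> thr" "0 \<le> t1" "t1 < t2"
      "\<forall>t\<in>{0..t2}. \<bar>S t - thr\<bar> < ?e" for S t1 t2
  proof -
    have "\<bar>S t1 - thr\<bar> = \<bar>S 0 - thr\<bar> * exp (rate * t1)"
      "\<bar>S t2 - thr\<bar> = \<bar>S 0 - thr\<bar> * exp (rate * t2)"
      by (rule trajectory_near_thr[OF that(1)]; use that in force)+
    then show ?thesis
      using that rate_pos by simp
  qed
  have leaves: "\<exists>t\<ge>0. ?e \<le> \<bar>S t - thr\<bar>"
    if S: "skill_trajectory \<kappa> M rule S" and S0: "S 0 \<noteq> thr" for S
  proof (rule ccontr)
    assume "\<not> ?thesis"
    then have near: "\<bar>S t - thr\<bar> < ?e" if "0 \<le> t" for t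
      using that by (meson not_le)
    \<comment> \<open>This time makes even the lower bound \<open>rate * T\<close> for
      \<open>exp (rate * T)\<close> large enough to reach the radius.\<close>
    define T where "T = ?e / (\<bar>S 0 - thr\<bar> * rate)"
    have T: "0 \<le> T" using order rate_pos by (simp add: T_def)
    have "?e = \<bar>S 0 - thr\<bar> * (rate * T)"
      using S0 rate_pos by (simp add: T_def)
    also have "\<dots> \<le> \<bar>S 0 - thr\<bar> * exp (rate * T)"
      using exp_ge_add_one_self[of "rate * T"] by (intro mult_left_mono) linarith+
    also have "\<dots> = \<bar>S T - thr\<bar>"
      using trajectory_near_thr[OF S T near] by simp
    finally show False using near[OF T] by simp
  qed
  have "skill_drift \<kappa> M thr (rule thr) = 0"
    using drift_mid[of thr] order by simp
  then show ?thesis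
    unfolding unstable_threshold_def using e away leaves by blast
qed

end

section \<open>Reflection and the upper side\<close>

text \<open>Substituting \<open>M - S\<close> and \<open>1 - u\<close> negates
  \<open>\<kappa> * M * (1 - u) - \<kappa> * S\<close>, just as reflecting the path negates its
  derivative.\<close>

lemma skill_trajectory_reflect:
  assumes S: "skill_trajectory \<kappa> M u S"
  shows "skill_trajectory \<kappa> M (\<lambda>x. 1 - u (M - x)) (\<lambda>t. M - S t)"
  unfolding skill_trajectory_def
proof (intro allI impI conjI)
  fix t :: real assume t: "0 \<le> t"
  show "M - S t \<in> {0..M}"
    using S t by (simp add: skill_trajectory_def)
  have "(S has_real_derivative skill_drift \<kappa> M (S t) (u (S t))) (at t within {0..})"
    using S t by (simp add: skill_trajectory_def)
  then show "((\<lambda>t. M - S t) has_real_derivative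
      skill_drift \<kappa> M (M - S t) (1 - u (M - (M - S t)))) (at t within {0..})"
    by (auto intro!: derivative_eq_intros simp: skill_drift_def algebra_simps)
qed

text \<open>The reflection is its own inverse, so it carries paths in both directions: one gives
  existence, the other the limit of every path.\<close>

lemma worker_converges_reflect:
  assumes "worker_converges \<kappa> M (\<lambda>x. 1 - u (M - x)) (M - S0) (M - L)"
  shows "worker_converges \<kappa> M u S0 L"
  unfolding worker_converges_def
proof (intro conjI allI impI; (elim conjE)?)
  obtain S where "skill_trajectory \<kappa> M (\<lambda>x. 1 - u (M - x)) S" "S 0 = M - S0"
    using assms by (auto simp: worker_converges_def)
  then show "\<exists>S. skill_trajectory \<kappa> M u S \<and> S 0 = S0"
    using skill_trajectory_reflect[of \<kappa> M "\<lambda>x. 1 - u (M - x)" S]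
    by (intro exI[of _ "\<lambda>t. M - S t"]) simp
next
  fix S assume "skill_trajectory \<kappa> M u S" "S 0 = S0"
  then have "((\<lambda>t. M - S t) \<longlongrightarrow> M - L) at_top"
    using assms skill_trajectory_reflect[of \<kappa> M u S] by (simp add: worker_converges_def)
  from tendsto_diff[OF tendsto_const[of M] this] show "(S \<longlongrightarrow> L) at_top"
    by (simp only: diff_diff_eq2 add_diff_cancel_left')
qed

context clipped_usage
begin

lemma converges_M:
  assumes "thr < S0" "S0 \<le> M"
  shows "worker_converges \<kappa> M rule S0 M"
proof (rule worker_converges_reflect)
  \<comment> \<open>The intercept comes from expanding \<open>1 - (u0 + u1 * (M - x))\<close>; the
    slope is unchanged, and the conditions \<open>1 < u0\<close> and \<open>u0 + u1 * M < 0\<close>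
    swap roles.\<close>
  interpret reflected: clipped_usage \<kappa> M "1 - u0 - u1 * M" u1
    by unfold_locales (use \<kappa> M u1 u0 uM in auto)
  have "reflected.rule = (\<lambda>x. 1 - rule (M - x))"
    unfolding reflected.rule_def rule_def feasible_usage_def by (rule ext) (simp add: algebra_simps)
  moreover have "reflected.thr = M - thr"
    unfolding reflected.thr_def thr_def using slope_gt_1 by (simp add: field_simps)
  ultimately show "worker_converges \<kappa> M (\<lambda>x. 1 - rule (M - x)) (M - S0) (M - M)"
    using reflected.converges_0[of "M - S0"] assms by simp
qed

end

theorem proposition8:
  fixes \<alpha> \<beta> \<gamma> \<kappa> \<delta> Smax :: real
  assumes "\<alpha> > 0" and "\<gamma> > 0" and "\<kappa> > 0" and "\<delta> > 0" and "Smax > 0"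
    and "0 < \<beta>" and "\<beta> < 1"
    and "discr \<beta> \<gamma> \<kappa> \<delta> Smax > 0"
    and "usage_u1 \<beta> \<gamma> \<kappa> \<delta> Smax < 0"
    and "interior_usage \<alpha> \<beta> \<gamma> \<kappa> \<delta> Smax 0 > 1"
    and "interior_usage \<alpha> \<beta> \<gamma> \<kappa> \<delta> Smax Smax < 0"
  shows "\<exists>Seq\<in>{0<..<Smax}.
    unstable_threshold \<kappa> Smax (feasible_usage (interior_usage \<alpha> \<beta> \<gamma> \<kappa> \<delta> Smax)) Seq \<and>
    (\<forall>S0\<in>{0..<Seq}.
       worker_converges \<kappa> Smax (feasible_usage (interior_usage \<alpha> \<beta> \<gamma> \<kappa> \<delta> Smax)) S0 0) \<and>
    (\<forall>S0\<in>{Seq<..Smax}.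
       worker_converges \<kappa> Smax (feasible_usage (interior_usage \<alpha> \<beta> \<gamma> \<kappa> \<delta> Smax)) S0 Smax)"
proof -
  \<comment> \<open>The interior usage at 0 and at \<open>Smax\<close> is \<open>u0\<close> and
    \<open>u0 + u1 * M\<close> of the locale.\<close>
  interpret clipped_usage \<kappa> Smax "usage_u0 \<alpha> \<beta> \<gamma> \<kappa> \<delta> Smax" "usage_u1 \<beta> \<gamma> \<kappa> \<delta> Smax"
    using assms by unfold_locales (simp_all add: interior_usage_def)
  have "feasible_usage (interior_usage \<alpha> \<beta> \<gamma> \<kappa> \<delta> Smax) = rule"
    by (simp add: rule_def interior_usage_def[abs_def])
  then show ?thesis
    using order unstable converges_0 converges_M by (intro bexI[of _ thr]) auto
qed

end
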